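(* Let $f^- : \bar{X} \to \bar{Y}$ be an arrow in the category $\mathbf{Prob}$ and let $v \in \mathcal{L}^1(\bar{Y})$ be independent of $f^-$. Then $$E^{f^-}(v) \sim_{\mathbb{P}_X} \mathbb{E}^{\mathbb{P}_Y}[v]\, E^{f^-}(1_Y).$$
   Context: The category $\mathbf{Prob}$ has all probability spaces $\bar{X} = (X,\Sigma_X,\mathbb{P}_X)$ as objects; an arrow $f^- : \bar{X} \to \bar{Y}$ is a symbol corresponding uniquely to a measurable function $f : Y \to X$ (note the reversed direction) that is null-preserving, i.e. $\mathbb{P}_X(A)=0$ implies $\mathbb{P}_Y(f^{-1}(A))=0$ for $A \in \Sigma_X$. Composition is $g^- \circ f^- = (f \circ g)^-$. The arrow $f^-$ is measure-preserving if $\mathbb{P}_Y \circ f^{-1} = \mathbb{P}_X$. $\mathcal{L}^1(\bar{X})$ is the vector space of $\mathbb{R}$-valued random variables on $\bar{X}$ integrable with respect to $\mathbb{P}_X$. For random variables, $u_1 \sim_{\mathbb{P}_X} u_2$ means $\mathbb{P}_X(u_1 \ne u_2) = 0$. $\mathbb{E}^{\mathbb{P}_Y}[v] = \int_Y v\, d\mathbb{P}_Y$, and $1_Y$ is the constant function $1$ on $Y$. Conditional expectation along an arrow: for $f^- : \bar{X} \to \bar{Y}$ in $\mathbf{Prob}$ and $v \in \mathcal{L}^1(\bar{Y})$, $E^{f^-}(v)$ denotes the element of $\mathcal{L}^1(\bar{X})$, unique up to $\mathbb{P}_X$-a.s. equality (it exists by the Radon-Nikodym theorem), such that $\int_A E^{f^-}(v)\,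 d\mathbb{P}_X = \int_{f^{-1}(A)} v \, d\mathbb{P}_Y$ for all $A \in \Sigma_X$. Independence of arrows: for a $\mathbf{Prob}$-arrow $f^- : \bar{X} \to \bar{Z}$ put $\bar{X}_{f^-} := (X, \Sigma_X, \mathbb{P}_Z \circ f^{-1})$, and let $f^\sim : \bar{X}_{f^-} \to \bar{Z}$ be the $\mathbf{Prob}$-arrow corresponding to the same function $f : Z \to X$. Two $\mathbf{Prob}$-arrows $f^- : \bar{X} \to \bar{Z}$ and $g^- : \bar{Y} \to \bar{Z}$ are independent if there exists a measure-preserving $\mathbf{Prob}$-arrow $q^- : \bar{X}_{f^-} \otimes \bar{Y}_{g^-} \to \bar{Z}$ with $q^- \circ p_1^- = f^\sim$ and $q^- \circ p_2^- = g^\sim$ (i.e. $p_1 \circ q = f$ and $p_2 \circ q = g$), where $\otimes$ denotes the product probability space (product $\sigma$-algebra and product measure) and $p_1, p_2$ are the projections of $X \times Y$. Independence of a random variable: for $v \in \mathcal{L}^1(\bar{Y})$ let $\bar{\mathbb{R}}_v := (\mathbb{R}, \mathcal{B}(\mathbb{R}), \mathbb{P}_Y \circ v^{-1})$, so that $v^- : \bar{\mathbb{R}}_v \to \bar{Y}$ is a $\mathbf{Prob}$-arrow. For a $\mathbf{Prob}$-arrow $f^- : \bar{X} \to \bar{Y}$, $v$ is said to be independent of $f^-$ if $f^-$ and $v^-$ are independent. *)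

theory Defs
  imports "HOL-Probability.Probability"
begin

text \<open>
  An arrow from \<open>X\<close> to \<open>Y\<close> in the category of probability spaces is represented by its
  underlying null-preserving measurable function, which runs in the opposite direction, from
  \<open>Y\<close> to \<open>X\<close>. Two functions determine the same arrow iff they agree on \<^term>\<open>space Y\<close>;
  composition of arrows is composition of functions in reverse order.
\<close>

definition prob_arrow :: "'a measure \<Rightarrow> 'b measure \<Rightarrow> ('b \<Rightarrow> 'a) \<Rightarrow> bool" where
  "prob_arrow X Y f \<longleftrightarrow>
     prob_space X \<and> prob_space Y \<and> f \<in> measurable Y X \<and>
     (\<forall>A\<in>sets X. emeasure X A = 0 \<longrightarrow> emeasure Y (f -` A \<inter> space Y) = 0)"

definition measure_preserving_arrow :: "'a measure \<Rightarrow> 'b measure \<Rightarrow> ('b \<Rightarrow> 'a) \<Rightarrow> bool" where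
  "measure_preserving_arrow X Y f \<longleftrightarrow> prob_arrow X Y f \<and> distr Y X f = X"

definition is_cond_exp_arrow ::
  "'a measure \<Rightarrow> 'b measure \<Rightarrow> ('b \<Rightarrow> 'a) \<Rightarrow> ('b \<Rightarrow> real) \<Rightarrow> ('a \<Rightarrow> real) \<Rightarrow> bool" where
  "is_cond_exp_arrow X Y f v w \<longleftrightarrow>
     integrable X w \<and>
     (\<forall>A\<in>sets X. (LINT x:A|X. w x) = (LINT y:(f -` A \<inter> space Y)|Y. v y))"

text \<open>
  The conditional expectation along an arrow is only determined almost surely, so
  \<open>cond_exp_arrow\<close> selects an arbitrary version. The lemmas \<open>is_cond_exp_arrow_cond_exp_arrow\<close>
  and \<open>is_cond_exp_arrow_unique\<close> below show that a version exists and that all versions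
  agree almost surely.
\<close>

definition cond_exp_arrow ::
  "'a measure \<Rightarrow> 'b measure \<Rightarrow> ('b \<Rightarrow> 'a) \<Rightarrow> ('b \<Rightarrow> real) \<Rightarrow> 'a \<Rightarrow> real" where
  "cond_exp_arrow X Y f v = (SOME w. is_cond_exp_arrow X Y f v w)"

text \<open>
  Here \<^term>\<open>distr Z X f\<close> is the space \<open>X\<close> equipped with the image measure under \<open>f\<close>, and the
  conditions on \<^term>\<open>fst \<circ> q\<close> and \<^term>\<open>snd \<circ> q\<close> say that \<open>q\<close> factors \<open>f\<close> and \<open>g\<close> through
  the projections of the product space.
\<close>

definition indep_arrows ::
  "'a measure \<Rightarrow> 'b measure \<Rightarrow> 'c measure \<Rightarrow> ('c \<Rightarrow> 'a) \<Rightarrow> ('c \<Rightarrow> 'b) \<Rightarrow> bool" where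
  "indep_arrows X Y Z f g \<longleftrightarrow>
     (\<exists>q. measure_preserving_arrow (distr Z X f \<Otimes>\<^sub>M distr Z Y g) Z q \<and>
          (\<forall>z\<in>space Z. (fst \<circ> q) z = f z \<and> (snd \<circ> q) z = g z))"

definition rv_indep_of_arrow ::
  "'a measure \<Rightarrow> 'b measure \<Rightarrow> ('b \<Rightarrow> 'a) \<Rightarrow> ('b \<Rightarrow> real) \<Rightarrow> bool" where
  "rv_indep_of_arrow X Y f v \<longleftrightarrow> indep_arrows X (distr Y borel v) Y f v"

lemma prob_arrow_random_variable:
  assumes "prob_space Y" "v \<in> borel_measurable Y"
  shows "prob_arrow (distr Y borel v) Y v"
  using assms by (auto simp: prob_arrow_def emeasure_distr intro: prob_space.prob_space_distr)

lemma is_cond_exp_arrow_unique: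
  assumes "is_cond_exp_arrow X Y f v w" "is_cond_exp_arrow X Y f v w'"
  shows "AE x in X. w x = w' x"
  using assms by (intro density_unique_real) (auto simp: is_cond_exp_arrow_def)

lemma is_cond_exp_arrow_diff:
  assumes f: "f \<in> measurable Y X"
    and v: "integrable Y v" "integrable Y v'"
    and w: "is_cond_exp_arrow X Y f v w" "is_cond_exp_arrow X Y f v' w'"
  shows "is_cond_exp_arrow X Y f (\<lambda>y. v y - v' y) (\<lambda>x. w x - w' x)"
proof -
  have "(LINT x:A|X. w x - w' x) = (LINT y:(f -` A \<inter> space Y)|Y. v y - v' y)"
    if A: "A \<in> sets X" for A
  proof -
    have B: "f -` A \<inter> space Y \<in> sets Y"
      using f A by (rule measurable_sets)
    have "set_integrable X A w" "set_integrable X A w'"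
      "set_integrable Y (f -` A \<inter> space Y) v" "set_integrable Y (f -` A \<inter> space Y) v'"
      using A B v w unfolding set_integrable_def is_cond_exp_arrow_def
      by (blast intro: integrable_mult_indicator)+
    then show ?thesis
      using w A by (simp add: set_integral_diff is_cond_exp_arrow_def)
  qed
  then show ?thesis
    using w by (auto simp: is_cond_exp_arrow_def)
qed

lemma is_cond_exp_arrow_exists_nonneg:
  assumes arr: "prob_arrow X Y f" and h: "integrable Y h" and pos: "\<And>y. 0 \<le> h y"
  shows "\<exists>w. is_cond_exp_arrow X Y f h w"
proof -
  interpret X: prob_space X using arr by (simp add: prob_arrow_def)
  have f[measurable]: "f \<in> measurable Y X" using arr by (simp add: prob_arrow_def)
  have [measurable]: "h \<in> borel_measurable Y" using h by auto
  define N where "N = distr (density Y (\<lambda>y. ennreal (h y))) X f"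
  have sN: "sets N = sets X" by (simp add: N_def)
  have eN: "emeasure N A = ennreal (LINT y:(f -` A \<inter> space Y)|Y. h y)"
    if A[measurable]: "A \<in> sets X" for A
  proof -
    have B: "f -` A \<inter> space Y \<in> sets Y" using f A by (rule measurable_sets)
    have "emeasure N A = (\<integral>\<^sup>+ y. ennreal (h y) * indicator (f -` A \<inter> space Y) y \<partial>Y)"
      using B unfolding N_def by (simp add: emeasure_distr emeasure_density)
    also have "\<dots> = (\<integral>\<^sup>+ y. ennreal (indicator (f -` A \<inter> space Y) y * h y) \<partial>Y)"
      by (intro nn_integral_cong) (auto split: split_indicator)
    also have "\<dots> = ennreal (\<integral>y. indicator (f -` A \<inter> space Y) y * h y \<partial>Y)"
      using integrable_mult_indicator[OF B h] pos by (intro nn_integral_eq_integral) auto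
    finally show ?thesis by (simp add: set_lebesgue_integral_def)
  qed
  have finN: "finite_measure N"
    by (rule finite_measureI) (use eN[of "space X"] in \<open>simp add: N_def\<close>)
  have ac: "absolutely_continuous X N"
    unfolding absolutely_continuous_def
  proof
    fix A assume "A \<in> null_sets X"
    then have A: "A \<in> sets X" "emeasure X A = 0" by auto
    then have "f -` A \<inter> space Y \<in> null_sets Y"
      using arr measurable_sets[OF f] by (auto simp: prob_arrow_def)
    then have "AE y in Y. y \<notin> f -` A \<inter> space Y" by (rule AE_not_in)
    then have "(LINT y:(f -` A \<inter> space Y)|Y. h y) = 0"
      unfolding set_lebesgue_integral_def by (intro integral_eq_zero_AE) auto
    then show "A \<in> null_sets N" using eN[OF A(1)] A(1) sN by auto
  qed
  obtain D where D[measurable]: "D \<in> borel_measurable X"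
    and DR: "AE x in X. RN_deriv X N x = ennreal (D x)" and D0: "\<And>x. 0 \<le> D x"
    using X.real_RN_deriv[OF finN ac sN] by metis
  have "density X (\<lambda>x. ennreal (D x)) = density X (RN_deriv X N)"
    using DR by (intro density_cong) auto
  then have dN: "density X (\<lambda>x. ennreal (D x)) = N"
    using X.density_RN_deriv[OF ac sN] by simp
  have eD: "(\<integral>\<^sup>+ x. ennreal (indicator A x * D x) \<partial>X) = ennreal (LINT y:(f -` A \<inter> space Y)|Y. h y)"
    if A[measurable]: "A \<in> sets X" for A
  proof -
    have "(\<integral>\<^sup>+ x. ennreal (indicator A x * D x) \<partial>X) = (\<integral>\<^sup>+ x. ennreal (D x) * indicator A x \<partial>X)"
      by (intro nn_integral_cong) (auto split: split_indicator)
    also have "\<dots> = emeasure N A" by (simp add: dN[symmetric] emeasure_density)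
    finally show ?thesis using eN[OF A] by simp
  qed
  have "(\<integral>\<^sup>+ x. ennreal (D x) \<partial>X) = (\<integral>\<^sup>+ x. ennreal (indicator (space X) x * D x) \<partial>X)"
    by (intro nn_integral_cong) auto
  also have "\<dots> < \<infinity>" by (simp add: eD)
  finally have "integrable X D" using D0 by (intro integrableI_nonneg) auto
  moreover have "(LINT x:A|X. D x) = (LINT y:(f -` A \<inter> space Y)|Y. h y)"
    if A[measurable]: "A \<in> sets X" for A
  proof -
    have "0 \<le> (LINT y:(f -` A \<inter> space Y)|Y. h y)"
      unfolding set_lebesgue_integral_def using pos by (intro Bochner_Integration.integral_nonneg) auto
    then show ?thesis
      using eD[OF A] D0 unfolding set_lebesgue_integral_def
      by (subst integral_eq_nn_integral) auto
  qed
  ultimately show ?thesis by (auto simp: is_cond_exp_arrow_def)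
qed

lemma is_cond_exp_arrow_cond_exp_arrow:
  assumes arr: "prob_arrow X Y f" and v: "integrable Y v"
  shows "is_cond_exp_arrow X Y f v (cond_exp_arrow X Y f v)"
proof -
  have i: "integrable Y (\<lambda>y. max 0 (v y))" "integrable Y (\<lambda>y. max 0 (- v y))"
    using v by auto
  obtain w w' where "is_cond_exp_arrow X Y f (\<lambda>y. max 0 (v y)) w"
    "is_cond_exp_arrow X Y f (\<lambda>y. max 0 (- v y)) w'"
    using is_cond_exp_arrow_exists_nonneg[OF arr] i by (metis max.cobounded1)
  then have "is_cond_exp_arrow X Y f (\<lambda>y. max 0 (v y) - max 0 (- v y)) (\<lambda>x. w x - w' x)"
    using arr i by (intro is_cond_exp_arrow_diff) (auto simp: prob_arrow_def)
  moreover have "(\<lambda>y. max 0 (v y) - max 0 (- v y)) = v"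
    by (auto simp: max_def)
  ultimately have "is_cond_exp_arrow X Y f v (\<lambda>x. w x - w' x)" by simp
  then show ?thesis unfolding cond_exp_arrow_def by (rule someI[where P = "is_cond_exp_arrow X Y f v"])
qed

end

theory Submission
  imports Defs
begin

text \<open>
  In the library, \<open>prob_space.indep_var\<close> requires both variables to have the same value type, so arrows
  into spaces of different types are independent in the library's sense only after
  composition with maps into a common type.
\<close>

lemma indep_arrows_imp_indep_var:
  fixes u :: "'a \<Rightarrow> 'd" and w :: "'b \<Rightarrow> 'd"
  assumes Z: "prob_space Z"
    and f[measurable]: "f \<in> measurable Z X" and g[measurable]: "g \<in> measurable Z Y"
    and ind: "indep_arrows X Y Z f g"
    and u[measurable]: "u \<in> measurable X S" and w[measurable]: "w \<in> measurable Y T"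
  shows "prob_space.indep_var Z S (u \<circ> f) T (w \<circ> g)"
proof -
  interpret Z: prob_space Z by (rule Z)
  let ?P = "distr Z X f \<Otimes>\<^sub>M distr Z Y g"
  obtain q where q: "measure_preserving_arrow ?P Z q"
    and qfg: "\<forall>z\<in>space Z. fst (q z) = f z \<and> snd (q z) = g z"
    using ind by (auto simp: indep_arrows_def)
  have [measurable]: "q \<in> measurable Z ?P"
    using q by (simp add: measure_preserving_arrow_def prob_arrow_def)
  \<comment> \<open>\<open>pair_measure_distr\<close> needs the second image measure to be
    sigma-finite; being a probability measure suffices.\<close>
  have "prob_space (distr Z T (w \<circ> g))"
    by (rule Z.prob_space_distr) simp
  then have "prob_space (distr (distr Z Y g) T w)"
    by (simp add: distr_distr)
  then have "distr (distr Z X f) S u \<Otimes>\<^sub>M distr (distr Z Y g) T w =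
      distr ?P (S \<Otimes>\<^sub>M T) (\<lambda>(x, y). (u x, w y))"
    by (intro pair_measure_distr) (auto intro: prob_space_imp_sigma_finite)
  \<comment> \<open>Measure preservation of \<open>q\<close> enters here: the product measure
    \<open>?P\<close> is itself the law of \<open>q\<close>, so the product of the marginal laws
    becomes a joint law on \<open>Z\<close>.\<close>
  also have "\<dots> = distr (distr Z ?P q) (S \<Otimes>\<^sub>M T) (\<lambda>(x, y). (u x, w y))"
    using q by (simp add: measure_preserving_arrow_def)
  also have "\<dots> = distr Z (S \<Otimes>\<^sub>M T) ((\<lambda>(x, y). (u x, w y)) \<circ> q)"
    by (rule distr_distr) measurable
  also have "\<dots> = distr Z (S \<Otimes>\<^sub>M T) (\<lambda>z. ((u \<circ> f) z, (w \<circ> g) z))"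
    using qfg by (intro distr_cong) (auto simp: case_prod_beta)
  finally show ?thesis
    by (simp add: Z.indep_var_distribution_eq distr_distr)
qed

text \<open>An integral over the preimage of \<open>A\<close> is the expectation of a product with
  \<open>indicat_real A \<circ> f\<close>. This factor is independent of \<open>v\<close>, so the
  expectation splits.\<close>

lemma set_lebesgue_integral_vimage_indep:
  assumes "prob_space Y" and f[measurable]: "f \<in> measurable Y X" and v: "integrable Y v"
    and ind: "rv_indep_of_arrow X Y f v" and A: "A \<in> sets X"
  shows "(LINT y:(f -` A \<inter> space Y)|Y. v y) =
    (LINT y|Y. v y) * (LINT y:(f -` A \<inter> space Y)|Y. 1)"
proof -
  interpret Y: prob_space Y by fact
  \<comment> \<open>The indicator moves \<open>f\<close> into the reals, where \<open>v\<close>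
    already lives; hence \<open>id\<close> on the other side.\<close>
  have "Y.indep_var borel (indicat_real A \<circ> f) borel (id \<circ> v)"
    using ind v A Y.prob_space_axioms f unfolding rv_indep_of_arrow_def
    by (intro indep_arrows_imp_indep_var[where X = X and Y = "distr Y borel v"]) auto
  moreover have "integrable Y (indicat_real A \<circ> f)"
    using A by (intro Y.integrable_const_bound[where B = 1]) (auto simp: comp_def)
  ultimately have "(LINT y|Y. indicat_real A (f y) * v y) =
      (LINT y|Y. indicat_real A (f y)) * (LINT y|Y. v y)"
    using Y.indep_var_lebesgue_integral[of "indicat_real A \<circ> f" v] v by simp
  \<comment> \<open>Kept general in \<open>h\<close> to cover both \<open>v\<close> and the constant
    1.\<close>
  moreover have "(LINT y:(f -` A \<inter> space Y)|Y. h y) = (LINT y|Y. indicat_real A (f y) * h y)"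
    for h :: "'a \<Rightarrow> real"
    unfolding set_lebesgue_integral_def
    by (intro Bochner_Integration.integral_cong) (auto split: split_indicator)
  ultimately show ?thesis by (simp add: mult.commute)
qed

theorem theorem5p12:
  fixes X :: "'a measure" and Y :: "'b measure"
    and f :: "'b \<Rightarrow> 'a" and v :: "'b \<Rightarrow> real"
  assumes "prob_arrow X Y f"
    and "integrable Y v"
    and "rv_indep_of_arrow X Y f v"
  shows "AE x in X. cond_exp_arrow X Y f v x =
           (LINT y|Y. v y) * cond_exp_arrow X Y f (\<lambda>_. 1) x"
proof -
  interpret Y: prob_space Y using assms(1) by (simp add: prob_arrow_def)
  have f: "f \<in> measurable Y X" using assms(1) by (simp add: prob_arrow_def)
  have one: "is_cond_exp_arrow X Y f (\<lambda>_. 1) (cond_exp_arrow X Y f (\<lambda>_. 1))"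
    using assms(1) by (rule is_cond_exp_arrow_cond_exp_arrow) simp
  \<comment> \<open>Versions are almost surely unique, so it suffices that the right-hand side is a
    version for \<open>v\<close>: the constant leaves the integral over each
    \<open>A\<close>.\<close>
  have "is_cond_exp_arrow X Y f v (\<lambda>x. (LINT y|Y. v y) * cond_exp_arrow X Y f (\<lambda>_. 1) x)"
    using one set_lebesgue_integral_vimage_indep[OF Y.prob_space_axioms f assms(2,3)]
    by (simp add: is_cond_exp_arrow_def)
  then show ?thesis
    using is_cond_exp_arrow_cond_exp_arrow[OF assms(1,2)] by (rule is_cond_exp_arrow_unique[rotated])
qed

end
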